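(* Let $G=(V,E)$ be an undirected graph with non-negative edge weights, let $\alpha\in(0,1)$, let $s\in V$ be a source node and let $r_{\max}\in(0,1)$. Run EdgePush with thresholds $$\theta(u,v)=\frac{r_{\max}\, d(v)\sqrt{\mathbf{A}_{uv}}}{\sum_{x\in N(v)}\sqrt{\mathbf{A}_{xv}}}\qquad\text{for each }\langle u,v\rangle\in\bar E .$$ Then the output $\hat{\boldsymbol\pi}$ satisfies $\left|\frac{\boldsymbol\pi_s(t)}{d(t)}-\frac{\hat{\boldsymbol\pi}(t)}{d(t)}\right|\le r_{\max}$ for every $t\in V$. Moreover, when $s$ is chosen at random according to the degree distribution ($\Pr[s=u]=d(u)/\|\mathbf{A}\|_1$), the expected overall running time of EdgePush is $$O\!\left(\frac{1-\alpha}{\alpha\, r_{\max}\,\|\mathbf{A}\|_1}\sum_{v\in V}\frac{\big(\sum_{x\in N(v)}\sqrt{\mathbf{A}_{xv}}\big)^2}{d(v)}\right).$$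
   Context: $G=(V,E)$ has $n=|V|$ nodes and $m=|E|$ edges; $\mathbf{A}$ is the symmetric weighted adjacency matrix ($\mathbf{A}_{uv}=\mathbf{A}_{vu}\ge 0$ is the weight of edge $\{u,v\}$, and $\mathbf{A}_{uv}=0$ if $\{u,v\}\notin E$). $\bar E$ is the set of $2m$ directed edges, containing both $\langle u,v\rangle$ and $\langle v,u\rangle$ for each $\{u,v\}\in E$. $N(u)$ is the set of neighbors of $u$, $d(u)=\sum_{v\in N(u)}\mathbf{A}_{uv}$ is the weighted degree (assumed positive), $\mathbf{D}=\mathrm{diag}(d(u))$, $\|\mathbf{A}\|_1=\sum_{\langle u,v\rangle\in\bar E}\mathbf{A}_{uv}$, and $\mathbf{P}=\mathbf{A}\mathbf{D}^{-1}$. For a node $x$, the Personalized PageRank vector with source $x$ is $\boldsymbol\pi_x=\alpha(\mathbf{I}-(1-\alpha)\mathbf{P})^{-1}\mathbf{e}_x$; $\boldsymbol\pi_x(t)$ is its entry at $t$. EdgePush: given thresholds $\theta(u,v)>0$ for $\langle u,v\rangle\in\bar E$, it maintains a node income vector $\mathbf q\in\mathbb R^V$ and edge expenses $\mathbf{Q}_{uv}$, initialized $\mathbf q=\mathbf e_s$, $\mathbf Q=\mathbf 0$. The edge residue is $\mathbf R_{uv}=(1-\alpha)\mathbf q(u)\mathbf A_{uv}/d(u)-\mathbf Q_{uv}$. While some $\langle u,v\rangle\in\bar E$ has $\mathbf R_{uv}\ge\theta(u,v)$, it picks an arbitrary such edge, sets $y=\mathbf R_{uv}$ and performs an edge-based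 push $\mathbf Q_{uv}\leftarrow\mathbf Q_{uv}+y$, $\mathbf q(v)\leftarrow\mathbf q(v)+y$. On termination it outputs $\hat{\boldsymbol\pi}=\alpha\mathbf q$. Running time is that of an implementation in which each edge-based push (including locating an eligible edge and all bookkeeping) costs $O(1)$ amortized time, excluding an $O(m)$ preprocessing of the graph. *)

theory Defs
  imports
    "HOL-Probability.Probability"
    "Jordan_Normal_Form.Gauss_Jordan_Elimination"
begin

definition directed_edges :: "nat set set \<Rightarrow> (nat \<times> nat) set" where
  "directed_edges E = {(u, v). {u, v} \<in> E}"

definition neighbors :: "nat set set \<Rightarrow> nat \<Rightarrow> nat set" where
  "neighbors E u = {v. {u, v} \<in> E}"

definition wdegree :: "nat set set \<Rightarrow> real mat \<Rightarrow> nat \<Rightarrow> real" where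
  "wdegree E A u = (\<Sum>v\<in>neighbors E u. A $$ (u, v))"

definition adj_norm1 :: "nat set set \<Rightarrow> real mat \<Rightarrow> real" where
  "adj_norm1 E A = (\<Sum>(u, v)\<in>directed_edges E. A $$ (u, v))"

text \<open>The node set is \<open>{..<n}\<close>. Edges are two-element sets, so there are no loops and
  every edge gives two directed edges. An edge may a priori have weight \<open>0\<close>.\<close>

definition weighted_graph :: "nat \<Rightarrow> nat set set \<Rightarrow> real mat \<Rightarrow> bool" where
  "weighted_graph n E A \<longleftrightarrow>
     0 < n \<and>
     E \<subseteq> {{u, v} | u v. u < n \<and> v < n \<and> u \<noteq> v} \<and>
     A \<in> carrier_mat n n \<and>
     (\<forall>u<n. \<forall>v<n. A $$ (u, v) = A $$ (v, u)) \<and>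
     (\<forall>u<n. \<forall>v<n. 0 \<le> A $$ (u, v)) \<and>
     (\<forall>u<n. \<forall>v<n. {u, v} \<notin> E \<longrightarrow> A $$ (u, v) = 0) \<and>
     (\<forall>u<n. 0 < wdegree E A u)"

text \<open>\<open>mat_inverse\<close> yields \<open>None\<close> on singular matrices; both matrices inverted below are
  invertible for a \<open>weighted_graph\<close> and \<open>0 < \<alpha> < 1\<close>.\<close>

definition transition_mat :: "nat \<Rightarrow> nat set set \<Rightarrow> real mat \<Rightarrow> real mat" where
  "transition_mat n E A = A * the (mat_inverse (mat_diag n (wdegree E A)))"

definition ppr :: "nat \<Rightarrow> nat set set \<Rightarrow> real mat \<Rightarrow> real \<Rightarrow> nat \<Rightarrow> nat \<Rightarrow> real" where
  "ppr n E A \<alpha> x t =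
     vec_index
       (\<alpha> \<cdot>\<^sub>v (the (mat_inverse (1\<^sub>m n - (1 - \<alpha>) \<cdot>\<^sub>m transition_mat n E A)) *\<^sub>v unit_vec n x)) t"

text \<open>A state of EdgePush consists of the node incomes and the edge expenses.\<close>

type_synonym push_state = "(nat \<Rightarrow> real) \<times> (nat \<times> nat \<Rightarrow> real)"

definition init_state :: "nat \<Rightarrow> push_state" where
  "init_state s = ((\<lambda>_. 0)(s := 1), \<lambda>_. 0)"

fun edge_residue ::
  "nat set set \<Rightarrow> real mat \<Rightarrow> real \<Rightarrow> push_state \<Rightarrow> nat \<times> nat \<Rightarrow> real" where
  "edge_residue E A \<alpha> (q, Q) (u, v) =
     (1 - \<alpha>) * q u * A $$ (u, v) / wdegree E A u - Q (u, v)"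

inductive push_step ::
  "nat set set \<Rightarrow> real mat \<Rightarrow> real \<Rightarrow> (nat \<times> nat \<Rightarrow> real) \<Rightarrow> push_state \<Rightarrow> push_state \<Rightarrow> bool"
  for E A \<alpha> \<theta> where
  "\<lbrakk>(u, v) \<in> directed_edges E; y = edge_residue E A \<alpha> (q, Q) (u, v); y \<ge> \<theta> (u, v)\<rbrakk> \<Longrightarrow>
     push_step E A \<alpha> \<theta> (q, Q) (q(v := q v + y), Q((u, v) := Q (u, v) + y))"

text \<open>\<open>\<sigma>\<close> is a complete execution of EdgePush from source \<open>s\<close> with \<open>N\<close> pushes: \<open>\<sigma> i\<close> is the state
  after \<open>i\<close> pushes (irrelevant for \<open>i > N\<close>), the eligible edges are chosen arbitrarily, and
  \<open>N = \<infinity>\<close> represents an execution that does not terminate.\<close>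

definition edge_push_run ::
  "nat set set \<Rightarrow> real mat \<Rightarrow> real \<Rightarrow> (nat \<times> nat \<Rightarrow> real) \<Rightarrow> nat \<Rightarrow>
   (nat \<Rightarrow> push_state) \<Rightarrow> enat \<Rightarrow> bool" where
  "edge_push_run E A \<alpha> \<theta> s \<sigma> N \<longleftrightarrow>
     \<sigma> 0 = init_state s \<and>
     (\<forall>i. enat i < N \<longrightarrow> push_step E A \<alpha> \<theta> (\<sigma> i) (\<sigma> (Suc i))) \<and>
     (\<forall>k. N = enat k \<longrightarrow> (\<forall>e\<in>directed_edges E. edge_residue E A \<alpha> (\<sigma> k) e < \<theta> e))"

definition edge_push_output :: "real \<Rightarrow> (nat \<Rightarrow> push_state) \<Rightarrow> enat \<Rightarrow> nat \<Rightarrow> real" where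
  "edge_push_output \<alpha> \<sigma> N t = \<alpha> * fst (\<sigma> (the_enat N)) t"

fun push_threshold :: "nat set set \<Rightarrow> real mat \<Rightarrow> real \<Rightarrow> nat \<times> nat \<Rightarrow> real" where
  "push_threshold E A r_max (u, v) =
     r_max * wdegree E A v * sqrt (A $$ (u, v)) / (\<Sum>x\<in>neighbors E v. sqrt (A $$ (x, v)))"

definition degree_distribution :: "nat \<Rightarrow> nat set set \<Rightarrow> real mat \<Rightarrow> nat pmf" where
  "degree_distribution n E A =
     embed_pmf (\<lambda>u. if u < n then wdegree E A u / adj_norm1 E A else 0)"

lemma sum_wdegree:
  assumes "weighted_graph n E A"
  shows "(\<Sum>u<n. wdegree E A u) = adj_norm1 E A"
proof -
  have E: "E \<subseteq> {{u, v} | u v. u < n \<and> v < n \<and> u \<noteq> v}"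
    using assms by (simp add: weighted_graph_def)
  have lt: "u < n \<and> v < n" if "{u, v} \<in> E" for u v
    using E that by (auto simp: doubleton_eq_iff dest!: subsetD)
  have fin: "finite (neighbors E u)" for u
    by (rule finite_subset[of _ "{..<n}"]) (auto simp: neighbors_def dest: lt)
  have "directed_edges E = Sigma {..<n} (neighbors E)"
    by (auto simp: directed_edges_def neighbors_def dest: lt)
  then show ?thesis
    by (simp add: adj_norm1_def wdegree_def sum.Sigma fin)
qed

lemma pmf_degree_distribution:
  assumes "weighted_graph n E A"
  shows "pmf (degree_distribution n E A) u =
           (if u < n then wdegree E A u / adj_norm1 E A else 0)"
proof -
  have n: "0 < n" and pos: "\<And>u. u < n \<Longrightarrow> 0 < wdegree E A u"
    using assms by (auto simp: weighted_graph_def)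
  have npos: "0 < adj_norm1 E A"
    unfolding sum_wdegree[OF assms, symmetric] using n pos by (intro sum_pos) auto
  let ?f = "\<lambda>u. if u < n then wdegree E A u / adj_norm1 E A else 0"
  have nonneg: "0 \<le> ?f u" for u
    using pos[of u] npos by auto
  have "(\<integral>\<^sup>+u. ennreal (?f u) \<partial>count_space UNIV) = (\<Sum>u<n. ennreal (?f u))"
    by (rule nn_integral_count_space'[where A = "{..<n}"]) auto
  also have "\<dots> = ennreal (\<Sum>u<n. ?f u)"
    by (rule sum_ennreal) (rule nonneg)
  also have "(\<Sum>u<n. ?f u) = 1"
    using npos sum_wdegree[OF assms] by (simp flip: sum_divide_distrib)
  finally show ?thesis
    unfolding degree_distribution_def using nonneg by (subst pmf_embed_pmf) auto
qed

end

theory Submission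
  imports Defs "Jordan_Normal_Form.Determinant"
begin

text \<open>Write \<open>M = I - (1 - \<alpha>) P\<close>. By a minimum principle for \<open>f / d\<close>, \<open>M f \<ge> 0\<close> implies \<open>f \<ge> 0\<close>;
  hence \<open>M\<close> is invertible and \<open>M f \<le> M g\<close> implies \<open>f \<le> g\<close>. Let \<open>r v\<close> be the total residue on the
  edges into \<open>v\<close>. EdgePush keeps the residues nonnegative and maintains \<open>M q = e\<^sub>s - r\<close>, so
  \<open>M (\<pi>\<^sub>s - \<alpha> q) = \<alpha> r\<close>. On termination \<open>0 \<le> r \<le> r\<^sub>m\<^sub>a\<^sub>x d\<close>, and since \<open>M d = \<alpha> d\<close>, comparison yields
  \<open>0 \<le> \<pi>\<^sub>s - \<alpha> q \<le> r\<^sub>m\<^sub>a\<^sub>x d\<close>.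

  Each push raises \<open>\<Sum>\<^sub>e Q\<^sub>e / \<theta>\<^sub>e\<close> by at least \<open>1\<close>, while \<open>Q\<^sub>u\<^sub>v \<le> (1 - \<alpha>) q(u) A\<^sub>u\<^sub>v / d(u)\<close> and
  \<open>\<alpha> q \<le> \<pi>\<^sub>s\<close>; this bounds the number of pushes. Comparison also gives \<open>\<Sum>\<^sub>s d(s) \<pi>\<^sub>s = d\<close>, which
  evaluates the average of the bound over the degree distribution.\<close>

section \<open>Weighted degrees and sums over directed edges\<close>

locale ppr_graph =
  fixes n :: nat and E :: "nat set set" and A :: "real mat" and \<alpha> :: real
  assumes graph: "weighted_graph n E A" and alpha_pos: "0 < \<alpha>" and alpha_less: "\<alpha> < 1"
begin

abbreviation d :: "nat \<Rightarrow> real" where "d \<equiv> wdegree E A"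

lemma
  shows n_pos: "0 < n"
    and A_carrier: "A \<in> carrier_mat n n"
    and A_sym: "u < n \<Longrightarrow> v < n \<Longrightarrow> A $$ (u, v) = A $$ (v, u)"
    and A_nonneg: "u < n \<Longrightarrow> v < n \<Longrightarrow> 0 \<le> A $$ (u, v)"
    and A_zero: "u < n \<Longrightarrow> v < n \<Longrightarrow> {u, v} \<notin> E \<Longrightarrow> A $$ (u, v) = 0"
    and d_pos: "u < n \<Longrightarrow> 0 < d u"
  using graph unfolding weighted_graph_def by auto

lemma d_nonzero: "u < n \<Longrightarrow> d u \<noteq> 0"
  using d_pos by force

lemma edge_cases:
  assumes "{u, v} \<in> E"
  shows "u < n" "v < n" "u \<noteq> v"
proof -
  have "E \<subseteq> {{u, v} | u v. u < n \<and> v < n \<and> u \<noteq> v}"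
    using graph unfolding weighted_graph_def by auto
  with assms obtain x y where "{u, v} = {x, y}" "x < n" "y < n" "x \<noteq> y"
    by blast
  then show "u < n" "v < n" "u \<noteq> v"
    by (auto simp: doubleton_eq_iff)
qed

lemma neighbors_subset: "neighbors E u \<subseteq> {..<n}"
  unfolding neighbors_def using edge_cases by blast

lemma finite_neighbors: "finite (neighbors E u)"
  using neighbors_subset finite_subset by blast

lemma directed_edges_Sigma: "directed_edges E = Sigma {..<n} (neighbors E)"
  by (auto simp: directed_edges_def neighbors_def dest: edge_cases)

lemma finite_directed_edges: "finite (directed_edges E)"
  unfolding directed_edges_Sigma by (simp add: finite_neighbors)

lemma mem_directed_edges: "(u, v) \<in> directed_edges E \<longleftrightarrow> u \<in> neighbors E v"
  by (auto simp: directed_edges_def neighbors_def insert_commute)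

text \<open>The thresholds are normalised over the edges entering a vertex, so sums are grouped by
  target. \<open>directed_edges_Sigma\<close> groups by source, hence the reversal of edges by
  \<open>prod.swap\<close>.\<close>

lemma sum_directed_edges:
  fixes f :: "nat \<times> nat \<Rightarrow> real"
  shows "(\<Sum>e\<in>directed_edges E. f e) = (\<Sum>v<n. \<Sum>u\<in>neighbors E v. f (u, v))"
proof -
  have "(\<Sum>v<n. \<Sum>u\<in>neighbors E v. f (u, v)) = (\<Sum>(v, u)\<in>directed_edges E. f (u, v))"
    unfolding directed_edges_Sigma by (subst sum.Sigma) (auto simp: finite_neighbors)
  also have "\<dots> = (\<Sum>e\<in>directed_edges E. f e)"
    by (rule sum.reindex_bij_witness[where i = prod.swap and j = prod.swap])
      (auto simp: directed_edges_def insert_commute)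
  finally show ?thesis by simp
qed

lemma sum_row:
  assumes "u < n"
  shows "(\<Sum>v<n. A $$ (u, v)) = d u"
  unfolding wdegree_def using assms neighbors_subset[of u]
  by (intro sum.mono_neutral_right) (auto simp: neighbors_def A_zero)

section \<open>The operator \<open>M\<close> and its comparison principle\<close>

text \<open>This is \<open>M\<close> acting on functions instead of vectors, so that comparison
  needs no dimension bookkeeping; \<open>ppr_mat_mult_vec\<close> links the two views.\<close>

definition ppr_op :: "(nat \<Rightarrow> real) \<Rightarrow> nat \<Rightarrow> real" where
  "ppr_op f v = f v - (1 - \<alpha>) * (\<Sum>u<n. A $$ (v, u) / d u * f u)"

lemma ppr_op_diff: "ppr_op (\<lambda>v. f v - g v) v = ppr_op f v - ppr_op g v"
  by (simp add: ppr_op_def right_diff_distrib sum_subtractf)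

lemma ppr_op_cmult: "ppr_op (\<lambda>v. c * f v) v = c * ppr_op f v"
  by (simp add: ppr_op_def algebra_simps sum_distrib_left)

lemma ppr_op_sum: "ppr_op (\<lambda>v. \<Sum>s\<in>S. f s v) v = (\<Sum>s\<in>S. ppr_op (f s) v)"
proof -
  have "(\<Sum>u<n. A $$ (v, u) / d u * (\<Sum>s\<in>S. f s u)) =
        (\<Sum>s\<in>S. \<Sum>u<n. A $$ (v, u) / d u * f s u)"
    unfolding sum_distrib_left by (rule sum.swap)
  then show ?thesis
    by (simp add: ppr_op_def sum_subtractf sum_distrib_left)
qed

text \<open>\<open>P\<close> fixes \<open>d\<close>: the division by \<open>d u\<close> cancels,
  leaving the sum of row \<open>v\<close>. Multiples of \<open>d\<close> thus serve as comparison
  functions below.\<close>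

lemma ppr_op_d:
  assumes "v < n"
  shows "ppr_op d v = \<alpha> * d v"
proof -
  have "(\<Sum>u<n. A $$ (v, u) / d u * d u) = (\<Sum>u<n. A $$ (v, u))"
    by (intro sum.cong) (auto simp: d_nonzero)
  then show ?thesis
    using sum_row[OF assms] by (simp add: ppr_op_def algebra_simps)
qed

text \<open>At a minimiser \<open>w\<close> of \<open>f / d\<close> one has \<open>ppr_op f w \<le> \<alpha> * f w\<close>.\<close>

lemma ppr_op_nonneg_imp_nonneg:
  assumes op: "\<And>v. v < n \<Longrightarrow> 0 \<le> ppr_op f v" and "v < n"
  shows "0 \<le> f v"
proof -
  let ?c = "Min ((\<lambda>u. f u / d u) ` {..<n})"
  have "?c \<in> (\<lambda>u. f u / d u) ` {..<n}"
    using n_pos by (intro Min_in) auto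
  then obtain w where w: "w < n" "?c = f w / d w" by auto
  have le: "?c * d u \<le> f u" if "u < n" for u
  proof -
    have "?c \<le> f u / d u" using that by (intro Min_le) auto
    then show ?thesis using d_pos[OF that] by (simp add: pos_le_divide_eq)
  qed
  \<comment> \<open>Here \<open>f w = ?c * d w\<close>, with \<open>d w\<close> expanded as the sum
    of row \<open>w\<close>; minimality of \<open>?c\<close> then bounds each summand.\<close>
  have "f w = (\<Sum>u<n. A $$ (w, u) * ?c)"
    unfolding sum_distrib_right[symmetric] using w d_nonzero[of w] by (simp add: sum_row)
  also have "\<dots> \<le> (\<Sum>u<n. A $$ (w, u) / d u * f u)"
  proof (rule sum_mono)
    fix u assume "u \<in> {..<n}"
    then have u: "u < n" by simp
    have "A $$ (w, u) * ?c = A $$ (w, u) / d u * (?c * d u)"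
      using d_pos[OF u] by simp
    also have "\<dots> \<le> A $$ (w, u) / d u * f u"
      using le[OF u] d_pos[OF u] A_nonneg[OF w(1) u] by (intro mult_left_mono) auto
    finally show "A $$ (w, u) * ?c \<le> A $$ (w, u) / d u * f u" .
  qed
  finally have "(1 - \<alpha>) * f w \<le> (1 - \<alpha>) * (\<Sum>u<n. A $$ (w, u) / d u * f u)"
    using alpha_less by (intro mult_left_mono) auto
  then have "ppr_op f w \<le> \<alpha> * f w"
    by (simp add: ppr_op_def algebra_simps)
  with op[OF w(1)] have "0 \<le> f w"
    using alpha_pos by (metis order_trans zero_le_mult_iff not_less)
  then have "0 \<le> ?c * d v"
    using w d_pos[of w] d_pos[OF \<open>v < n\<close>] by simp
  with le[OF \<open>v < n\<close>] show ?thesis by linarith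
qed

lemma ppr_op_le_imp_le:
  assumes "\<And>v. v < n \<Longrightarrow> ppr_op f v \<le> ppr_op g v" and "v < n"
  shows "f v \<le> g v"
  using ppr_op_nonneg_imp_nonneg[of "\<lambda>v. g v - f v" v] assms by (simp add: ppr_op_diff)

lemma ppr_op_eq_imp_eq:
  assumes "\<And>v. v < n \<Longrightarrow> ppr_op f v = ppr_op g v" and "v < n"
  shows "f v = g v"
  using assms ppr_op_le_imp_le[of f g v] ppr_op_le_imp_le[of g f v] by fastforce

section \<open>From the matrix definition of PageRank to \<open>ppr_op\<close>\<close>

text \<open>The explicit two-sided inverse puts the diagonal matrix in \<open>Units\<close>, which
  rules out \<open>None\<close>; uniqueness of inverses then identifies the matrix returned.\<close>

lemma mat_inverse_diag_wdegree:
  "the (mat_inverse (mat_diag n d)) = mat_diag n (\<lambda>u. 1 / d u)"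
proof -
  let ?D = "mat_diag n d" and ?B = "mat_diag n (\<lambda>u. 1 / d u)"
  have one: "mat_diag n (\<lambda>i. d i * (1 / d i)) = 1\<^sub>m n"
    by (intro eq_matI) (auto simp: mat_diag_def d_nonzero)
  have DB: "?D * ?B = 1\<^sub>m n" and BD: "?B * ?D = 1\<^sub>m n"
    using one by (simp_all add: mult.commute)
  have "?D \<in> Units (ring_mat TYPE(real) n ())"
    using DB BD by (auto simp: Units_def ring_mat_simps intro!: exI[of _ ?B] bexI[of _ ?B])
  then obtain B where B: "mat_inverse ?D = Some B"
    using mat_inverse(1)[of ?D n] by fastforce
  from mat_inverse(2)[OF mat_diag_dim B] have "?D * B = 1\<^sub>m n" and car: "B \<in> carrier_mat n n"
    by auto
  have "B = (?B * ?D) * B" using BD car by simp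
  also have "\<dots> = ?B * (?D * B)" using car by (intro assoc_mult_mat[of _ n n _ n]) auto
  also have "\<dots> = ?B" using \<open>?D * B = 1\<^sub>m n\<close> by (simp add: right_mult_one_mat[of _ n])
  finally show ?thesis using B by simp
qed

lemma transition_mat_eq:
  "transition_mat n E A = Matrix.mat n n (\<lambda>(i, j). A $$ (i, j) / d j)"
  unfolding transition_mat_def mat_inverse_diag_wdegree
  using mat_diag_mult_right[OF A_carrier] by simp

definition ppr_mat :: "real mat" where
  "ppr_mat = 1\<^sub>m n - (1 - \<alpha>) \<cdot>\<^sub>m transition_mat n E A"

lemma ppr_mat_carrier: "ppr_mat \<in> carrier_mat n n"
  unfolding ppr_mat_def transition_mat_eq by (intro minus_carrier_mat) simp

lemma ppr_mat_mult_vec: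
  assumes "x \<in> carrier_vec n" "v < n"
  shows "vec_index (ppr_mat *\<^sub>v x) v = ppr_op (vec_index x) v"
proof -
  have "vec_index (ppr_mat *\<^sub>v x) v =
      (\<Sum>u<n. ((if v = u then 1 else 0) - (1 - \<alpha>) * (A $$ (v, u) / d u)) * vec_index x u)"
    using assms
    by (simp add: ppr_mat_def transition_mat_eq scalar_prod_def lessThan_atLeast0 row_def)
  also have "\<dots> = (\<Sum>u<n. if v = u then vec_index x u else 0) -
      (1 - \<alpha>) * (\<Sum>u<n. A $$ (v, u) / d u * vec_index x u)"
    unfolding sum_distrib_left sum_subtractf[symmetric]
    by (intro sum.cong) (auto simp: algebra_simps)
  finally show ?thesis using assms by (simp add: ppr_op_def)
qed

text \<open>A kernel vector has the same image under \<open>ppr_op\<close> as the zero function, so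
  comparison in both directions makes it vanish.\<close>

lemma ppr_mat_inverse:
  obtains B where "mat_inverse ppr_mat = Some B" "ppr_mat * B = 1\<^sub>m n" "B \<in> carrier_mat n n"
proof -
  have "det ppr_mat \<noteq> 0"
  proof
    assume "det ppr_mat = 0"
    then obtain x where x: "x \<in> carrier_vec n" "x \<noteq> 0\<^sub>v n" "ppr_mat *\<^sub>v x = 0\<^sub>v n"
      using det_0_iff_vec_prod_zero_field[OF ppr_mat_carrier] by auto
    have "vec_index x v = 0" if "v < n" for v
    proof (rule ppr_op_eq_imp_eq[OF _ that, where g = "\<lambda>_. 0"])
      fix w assume "w < n"
      then show "ppr_op (vec_index x) w = ppr_op (\<lambda>_. 0) w"
        using ppr_mat_mult_vec[OF x(1), of w] x(3) by (simp add: ppr_op_def)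
    qed
    then have "x = 0\<^sub>v n" using x(1) by (intro eq_vecI) auto
    with x(2) show False by simp
  qed
  then have "ppr_mat \<in> Units (ring_mat TYPE(real) n ())"
    by (rule det_non_zero_imp_unit[OF ppr_mat_carrier])
  then obtain B where "mat_inverse ppr_mat = Some B"
    using mat_inverse(1)[OF ppr_mat_carrier] by fastforce
  with mat_inverse(2)[OF ppr_mat_carrier this] show ?thesis using that by blast
qed

text \<open>From here on \<open>ppr\<close> is used only through this equation and comparison, never
  through its matrix definition.\<close>

lemma ppr_op_ppr:
  assumes "s < n" "t < n"
  shows "ppr_op (ppr n E A \<alpha> s) t = (if t = s then \<alpha> else 0)"
proof -
  obtain B where B: "mat_inverse ppr_mat = Some B" "ppr_mat * B = 1\<^sub>m n" "B \<in> carrier_mat n n"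
    by (rule ppr_mat_inverse)
  let ?x = "B *\<^sub>v unit_vec n s"
  have x: "?x \<in> carrier_vec n" using B by simp
  have eq: "ppr n E A \<alpha> s u = \<alpha> * vec_index ?x u" if "u < n" for u
    using that B x by (simp add: ppr_def ppr_mat_def[symmetric])
  \<comment> \<open>At \<open>t < n\<close>, \<open>ppr_op\<close> reads its argument only at
    indices below \<open>n\<close>, where \<open>eq\<close> applies.\<close>
  have "ppr_op (ppr n E A \<alpha> s) t = ppr_op (\<lambda>u. \<alpha> * vec_index ?x u) t"
    using eq assms by (simp add: ppr_op_def)
  also have "\<dots> = \<alpha> * vec_index (ppr_mat *\<^sub>v ?x) t"
    using ppr_mat_mult_vec[OF x assms(2)] by (simp add: ppr_op_cmult)
  also have "ppr_mat *\<^sub>v ?x = unit_vec n s"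
    using B ppr_mat_carrier by (simp flip: assoc_mult_mat_vec)
  finally show ?thesis using assms by simp
qed

text \<open>Both sides have image \<alpha> d under \<open>M\<close>: the left by superposing the
  sources with weights \<open>d s\<close>, the right by \<open>ppr_op_d\<close>.\<close>

lemma sum_wdegree_ppr:
  assumes "t < n"
  shows "(\<Sum>s<n. d s * ppr n E A \<alpha> s t) = d t"
proof (rule ppr_op_eq_imp_eq[OF _ assms])
  fix v assume v: "v < n"
  have "ppr_op (\<lambda>t. \<Sum>s<n. d s * ppr n E A \<alpha> s t) v = (\<Sum>s<n. if v = s then \<alpha> * d s else 0)"
    unfolding ppr_op_sum ppr_op_cmult using v
    by (intro sum.cong) (auto simp: ppr_op_ppr)
  then show "ppr_op (\<lambda>t. \<Sum>s<n. d s * ppr n E A \<alpha> s t) v = ppr_op d v"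
    using v by (simp add: ppr_op_d)
qed

section \<open>Invariant of EdgePush and the two-sided bound on its output\<close>

text \<open>The second condition is the accounting of income: the initial unit plus whatever was
  pushed along incoming edges. It is what makes \<open>M q = e_s - r\<close> hold, as derived in
  \<open>ppr_op_income\<close>.\<close>

definition push_invariant :: "nat \<Rightarrow> push_state \<Rightarrow> bool" where
  "push_invariant s \<tau> \<longleftrightarrow>
     (\<forall>e\<in>directed_edges E. 0 \<le> edge_residue E A \<alpha> \<tau> e) \<and>
     (\<forall>v<n. fst \<tau> v = (if v = s then 1 else 0) + (\<Sum>u\<in>neighbors E v. snd \<tau> (u, v)))"

lemma push_invariant_init: "push_invariant s (init_state s)"
proof -
  have "0 \<le> edge_residue E A \<alpha> (init_state s) (u, v)" if "(u, v) \<in> directed_edges E" for u v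
  proof -
    have "u < n" "v < n" using that edge_cases[of u v] by (auto simp: directed_edges_def)
    then show ?thesis
      using A_nonneg[of u v] d_pos[of u] alpha_less by (simp add: init_state_def)
  qed
  then show ?thesis by (auto simp: push_invariant_def init_state_def)
qed

text \<open>The pushed amount \<open>y\<close> is a residue, hence nonnegative. A push clears the
  residue of its own edge, raises those of the edges leaving \<open>v\<close> and leaves the others
  alone.\<close>

lemma push_invariant_step:
  assumes inv: "push_invariant s \<tau>" and step: "push_step E A \<alpha> \<theta> \<tau> \<tau>'"
  shows "push_invariant s \<tau>'"
  using step
proof cases
  case (1 u v y q Q)
  have uv: "u < n" "v < n" "u \<noteq> v" "u \<in> neighbors E v"
    using 1(3) edge_cases[of u v] by (auto simp: directed_edges_def neighbors_def insert_commute)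
  have y: "0 \<le> y"
    using inv 1 by (auto simp: push_invariant_def)
  have "0 \<le> edge_residue E A \<alpha> \<tau>' (a, b)" if ab: "(a, b) \<in> directed_edges E" for a b
  proof (cases "(a, b) = (u, v)")
    case True
    \<comment> \<open>Since \<open>u \<noteq> v\<close>, the income of \<open>u\<close> is unchanged
      and the new residue is exactly 0.\<close>
    then show ?thesis using 1 uv by simp
  next
    case False
    have lt: "a < n" "b < n" using ab edge_cases[of a b] by (auto simp: directed_edges_def)
    have "0 \<le> edge_residue E A \<alpha> \<tau> (a, b)"
      using inv ab by (auto simp: push_invariant_def)
    moreover have "edge_residue E A \<alpha> \<tau>' (a, b) = edge_residue E A \<alpha> \<tau> (a, b) +
        (if a = v then (1 - \<alpha>) * y * A $$ (a, b) / d a else 0)"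
      using False by (auto simp: 1(1,2) distrib_left distrib_right add_divide_distrib)
    moreover have "0 \<le> (1 - \<alpha>) * y * A $$ (a, b) / d a"
      using y lt A_nonneg d_pos[of a] alpha_less by simp
    ultimately show ?thesis by auto
  qed
  moreover have "fst \<tau>' w = (if w = s then 1 else 0) + (\<Sum>x\<in>neighbors E w. snd \<tau>' (x, w))"
    if w: "w < n" for w
  proof -
    have "(\<Sum>x\<in>neighbors E w. snd \<tau>' (x, w)) =
        (\<Sum>x\<in>neighbors E w. snd \<tau> (x, w) + (if x = u then if w = v then y else 0 else 0))"
      using 1 by (intro sum.cong) auto
    also have "\<dots> = (\<Sum>x\<in>neighbors E w. snd \<tau> (x, w)) + (if w = v then y else 0)"
      using uv by (auto simp: sum.distrib finite_neighbors)
    finally show ?thesis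
      using inv w 1 by (auto simp: push_invariant_def)
  qed
  ultimately show ?thesis by (auto simp: push_invariant_def)
qed

text \<open>Sum the residues over the edges into \<open>v\<close>: by symmetry of \<open>A\<close>
  the first terms give \<open>(1 - \<alpha>) (P q)(v)\<close>, and by the invariant the expenses
  give \<open>q v\<close> minus the initial unit.\<close>

lemma ppr_op_income:
  assumes inv: "push_invariant s \<tau>" and v: "v < n"
  shows "ppr_op (\<lambda>u. \<alpha> * fst \<tau> u) v =
    \<alpha> * ((if v = s then 1 else 0) - (\<Sum>u\<in>neighbors E v. edge_residue E A \<alpha> \<tau> (u, v)))"
proof -
  obtain q Q where \<tau>: "\<tau> = (q, Q)" by (cases \<tau>)
  have "(\<Sum>u\<in>neighbors E v. edge_residue E A \<alpha> \<tau> (u, v)) =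
      (\<Sum>u\<in>neighbors E v. (1 - \<alpha>) * (A $$ (v, u) / d u * q u)) - (\<Sum>u\<in>neighbors E v. Q (u, v))"
    unfolding sum_subtractf[symmetric] using v neighbors_subset[of v]
    by (intro sum.cong) (auto simp: \<tau> A_sym[of _ v])
  also have "(\<Sum>u\<in>neighbors E v. (1 - \<alpha>) * (A $$ (v, u) / d u * q u)) =
      (\<Sum>u<n. (1 - \<alpha>) * (A $$ (v, u) / d u * q u))"
    using v neighbors_subset[of v]
    by (intro sum.mono_neutral_left) (auto simp: neighbors_def A_zero)
  also have "(\<Sum>u\<in>neighbors E v. Q (u, v)) = q v - (if v = s then 1 else 0)"
    using inv v by (auto simp: push_invariant_def \<tau>)
  finally show ?thesis
    unfolding ppr_op_cmult by (simp add: ppr_op_def \<tau> sum_distrib_left)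
qed

text \<open>The residues enter \<open>M (\<alpha> q)\<close> with a negative sign. The bound holds
  in every reachable state, so it serves the push count as well as the final error.\<close>

lemma income_le_ppr:
  assumes inv: "push_invariant s \<tau>" and "s < n" "t < n"
  shows "\<alpha> * fst \<tau> t \<le> ppr n E A \<alpha> s t"
proof (rule ppr_op_le_imp_le[OF _ \<open>t < n\<close>])
  fix v assume v: "v < n"
  have "0 \<le> (\<Sum>u\<in>neighbors E v. edge_residue E A \<alpha> \<tau> (u, v))"
    using inv by (intro sum_nonneg) (auto simp: push_invariant_def mem_directed_edges)
  then show "ppr_op (\<lambda>u. \<alpha> * fst \<tau> u) v \<le> ppr_op (ppr n E A \<alpha> s) v"
    using alpha_pos by (auto simp: ppr_op_income[OF inv v] ppr_op_ppr[OF \<open>s < n\<close> v])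
qed

text \<open>The error has image \<alpha> r under \<open>M\<close>, while \<epsilon> d has image
  \<alpha> \<epsilon> d; the factor \<alpha> occurs on both sides, so the error inherits the bound
  on \<open>r\<close> without loss.\<close>

lemma ppr_le_income:
  assumes inv: "push_invariant s \<tau>" and "s < n" "t < n"
    and res: "\<And>v. v < n \<Longrightarrow> (\<Sum>u\<in>neighbors E v. edge_residue E A \<alpha> \<tau> (u, v)) \<le> \<epsilon> * d v"
  shows "ppr n E A \<alpha> s t \<le> \<alpha> * fst \<tau> t + \<epsilon> * d t"
proof -
  have "ppr n E A \<alpha> s t - \<alpha> * fst \<tau> t \<le> \<epsilon> * d t"
  proof (rule ppr_op_le_imp_le[OF _ \<open>t < n\<close>])
    fix v assume v: "v < n"
    have "ppr_op (\<lambda>t. ppr n E A \<alpha> s t - \<alpha> * fst \<tau> t) v =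
        \<alpha> * (\<Sum>u\<in>neighbors E v. edge_residue E A \<alpha> \<tau> (u, v))"
      by (simp add: ppr_op_diff ppr_op_income[OF inv v] ppr_op_ppr[OF \<open>s < n\<close> v] algebra_simps)
    also have "\<dots> \<le> \<alpha> * (\<epsilon> * d v)"
      using res[OF v] alpha_pos by (intro mult_left_mono) auto
    finally show "ppr_op (\<lambda>t. ppr n E A \<alpha> s t - \<alpha> * fst \<tau> t) v \<le> ppr_op (\<lambda>t. \<epsilon> * d t) v"
      by (simp add: ppr_op_cmult ppr_op_d[OF v] algebra_simps)
  qed
  then show ?thesis by simp
qed

section \<open>Termination, accuracy and expected push count for general thresholds\<close>

lemma push_step_expense_increase:
  assumes pos: "\<And>e. e \<in> directed_edges E \<Longrightarrow> 0 < \<theta> e" and step: "push_step E A \<alpha> \<theta> \<tau> \<tau>'"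
  shows "(\<Sum>e\<in>directed_edges E. snd \<tau> e / \<theta> e) + 1 \<le> (\<Sum>e\<in>directed_edges E. snd \<tau>' e / \<theta> e)"
  using step
proof cases
  case (1 u v y q Q)
  have "(\<Sum>e\<in>directed_edges E. snd \<tau>' e / \<theta> e) =
      (\<Sum>e\<in>directed_edges E. snd \<tau> e / \<theta> e + (if e = (u, v) then y / \<theta> (u, v) else 0))"
    by (intro sum.cong) (auto simp: 1(1,2) add_divide_distrib simp flip: 1(4))
  also have "\<dots> = (\<Sum>e\<in>directed_edges E. snd \<tau> e / \<theta> e) + y / \<theta> (u, v)"
    using 1(3) by (simp add: sum.distrib finite_directed_edges)
  moreover have "1 \<le> y / \<theta> (u, v)"
    using pos[OF 1(3)] 1(5) by simp
  ultimately show ?thesis by linarith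
qed

text \<open>The potential starts at 0 and grows by at least 1 per push, so it dominates the number
  of pushes. Indexing by \<open>enat i \<le> N\<close> covers nonterminating runs too.\<close>

lemma run_invariant:
  assumes pos: "\<And>e. e \<in> directed_edges E \<Longrightarrow> 0 < \<theta> e"
    and run: "edge_push_run E A \<alpha> \<theta> s \<sigma> N" and "enat i \<le> N"
  shows "push_invariant s (\<sigma> i) \<and> real i \<le> (\<Sum>e\<in>directed_edges E. snd (\<sigma> i) e / \<theta> e)"
  using \<open>enat i \<le> N\<close>
proof (induction i)
  case 0
  then show ?case
    using run push_invariant_init by (auto simp: edge_push_run_def init_state_def)
next
  case (Suc i)
  then have "enat i < N" by (simp add: Suc_ile_eq)
  then have "push_step E A \<alpha> \<theta> (\<sigma> i) (\<sigma> (Suc i))"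
    using run by (auto simp: edge_push_run_def)
  from push_invariant_step[OF _ this] push_step_expense_increase[OF pos this] show ?case
    using Suc.IH \<open>enat i < N\<close> by (simp add: less_imp_le)
qed

text \<open>The bound depends neither on \<open>i\<close> nor on the choice of edges, so it also
  yields termination in \<open>run_finite\<close>.\<close>

lemma push_count_le:
  assumes pos: "\<And>e. e \<in> directed_edges E \<Longrightarrow> 0 < \<theta> e"
    and run: "edge_push_run E A \<alpha> \<theta> s \<sigma> N" and "enat i \<le> N" and "s < n"
  shows "real i \<le> (\<Sum>(u, v)\<in>directed_edges E.
    (1 - \<alpha>) / \<alpha> * (A $$ (u, v) / (d u * \<theta> (u, v))) * ppr n E A \<alpha> s u)"
proof -
  have inv: "push_invariant s (\<sigma> i)"
    and le: "real i \<le> (\<Sum>e\<in>directed_edges E. snd (\<sigma> i) e / \<theta> e)"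
    using run_invariant[OF pos run \<open>enat i \<le> N\<close>] by auto
  obtain q Q where \<sigma>: "\<sigma> i = (q, Q)" by (cases "\<sigma> i")
  note le
  also have "(\<Sum>e\<in>directed_edges E. snd (\<sigma> i) e / \<theta> e) \<le> (\<Sum>(u, v)\<in>directed_edges E.
    (1 - \<alpha>) / \<alpha> * (A $$ (u, v) / (d u * \<theta> (u, v))) * ppr n E A \<alpha> s u)"
  proof (rule sum_mono, clarify)
    fix u v assume e: "(u, v) \<in> directed_edges E"
    then have lt: "u < n" "v < n" using edge_cases[of u v] by (auto simp: directed_edges_def)
    have "0 \<le> edge_residue E A \<alpha> (\<sigma> i) (u, v)"
      using inv e by (auto simp: push_invariant_def)
    then have "Q (u, v) \<le> (1 - \<alpha>) / \<alpha> * A $$ (u, v) / d u * (\<alpha> * q u)"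
      using alpha_pos by (simp add: \<sigma> ac_simps)
    also have "\<dots> \<le> (1 - \<alpha>) / \<alpha> * A $$ (u, v) / d u * ppr n E A \<alpha> s u"
      using income_le_ppr[OF inv \<open>s < n\<close> lt(1)] alpha_pos alpha_less A_nonneg[OF lt] d_pos[OF lt(1)]
      by (intro mult_left_mono) (auto simp: \<sigma>)
    finally have "Q (u, v) / \<theta> (u, v) \<le>
        (1 - \<alpha>) / \<alpha> * A $$ (u, v) / d u * ppr n E A \<alpha> s u / \<theta> (u, v)"
      using pos[OF e] by (intro divide_right_mono) auto
    then show "snd (\<sigma> i) (u, v) / \<theta> (u, v) \<le>
        (1 - \<alpha>) / \<alpha> * (A $$ (u, v) / (d u * \<theta> (u, v))) * ppr n E A \<alpha> s u"
      by (simp add: \<sigma>)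
  qed
  finally show ?thesis .
qed

lemma run_finite:
  assumes "\<And>e. e \<in> directed_edges E \<Longrightarrow> 0 < \<theta> e"
    and "edge_push_run E A \<alpha> \<theta> s \<sigma> N" and "s < n"
  shows "N \<noteq> \<infinity>"
proof
  assume "N = \<infinity>"
  then have "real i \<le> (\<Sum>(u, v)\<in>directed_edges E.
    (1 - \<alpha>) / \<alpha> * (A $$ (u, v) / (d u * \<theta> (u, v))) * ppr n E A \<alpha> s u)" for i
    using push_count_le[OF assms(1,2) _ assms(3), of i] by simp
  then show False
    using reals_Archimedean2 not_less by blast
qed

text \<open>Termination bounds every residue by its threshold; the condition on the thresholds into
  each \<open>v\<close> turns this into r \<le> \<epsilon> d.\<close>

lemma run_error:
  assumes pos: "\<And>e. e \<in> directed_edges E \<Longrightarrow> 0 < \<theta> e"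
    and run: "edge_push_run E A \<alpha> \<theta> s \<sigma> N" and "s < n" "t < n"
    and \<theta>: "\<And>v. v < n \<Longrightarrow> (\<Sum>u\<in>neighbors E v. \<theta> (u, v)) \<le> \<epsilon> * d v"
  shows "\<bar>ppr n E A \<alpha> s t / d t - edge_push_output \<alpha> \<sigma> N t / d t\<bar> \<le> \<epsilon>"
proof -
  obtain k where k: "N = enat k" using run_finite[OF pos run \<open>s < n\<close>] by auto
  have inv: "push_invariant s (\<sigma> k)" using run_invariant[OF pos run, of k] k by simp
  have res: "(\<Sum>u\<in>neighbors E v. edge_residue E A \<alpha> (\<sigma> k) (u, v)) \<le> \<epsilon> * d v" if v: "v < n" for v
  proof -
    have "(\<Sum>u\<in>neighbors E v. edge_residue E A \<alpha> (\<sigma> k) (u, v)) \<le> (\<Sum>u\<in>neighbors E v. \<theta> (u, v))"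
      using run k by (intro sum_mono) (auto simp: edge_push_run_def mem_directed_edges less_imp_le)
    with \<theta>[OF v] show ?thesis by linarith
  qed
  have "0 \<le> ppr n E A \<alpha> s t - edge_push_output \<alpha> \<sigma> N t"
    "ppr n E A \<alpha> s t - edge_push_output \<alpha> \<sigma> N t \<le> \<epsilon> * d t"
    using income_le_ppr[OF inv \<open>s < n\<close> \<open>t < n\<close>] ppr_le_income[OF inv \<open>s < n\<close> \<open>t < n\<close> res]
    by (auto simp: edge_push_output_def k)
  then show ?thesis
    using d_pos[OF \<open>t < n\<close>] by (simp flip: diff_divide_distrib add: pos_divide_le_eq)
qed

text \<open>The average is kept unnormalised. After exchanging the sums,
  \<open>sum_wdegree_ppr\<close> produces a factor \<open>d u\<close> that cancels the
  \<open>1 / d u\<close> of \<open>push_count_le\<close>.\<close>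

lemma expected_push_count_le:
  assumes pos: "\<And>e. e \<in> directed_edges E \<Longrightarrow> 0 < \<theta> e"
    and run: "\<And>s. s < n \<Longrightarrow> edge_push_run E A \<alpha> \<theta> s (\<sigma> s) (enat (N s))"
  shows "(\<Sum>s<n. d s * real (N s)) \<le>
    (1 - \<alpha>) / \<alpha> * (\<Sum>(u, v)\<in>directed_edges E. A $$ (u, v) / \<theta> (u, v))"
proof -
  let ?w = "\<lambda>(u, v). (1 - \<alpha>) / \<alpha> * (A $$ (u, v) / (d u * \<theta> (u, v)))"
  have "(\<Sum>s<n. d s * real (N s)) \<le>
      (\<Sum>s<n. d s * (\<Sum>e\<in>directed_edges E. ?w e * ppr n E A \<alpha> s (fst e)))"
  proof (intro sum_mono mult_left_mono)
    fix s assume "s \<in> {..<n}"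
    then have s: "s < n" by simp
    show "real (N s) \<le> (\<Sum>e\<in>directed_edges E. ?w e * ppr n E A \<alpha> s (fst e))"
      using push_count_le[OF pos run[OF s] _ s, of "N s"] by (simp add: case_prod_beta)
    show "0 \<le> d s" using d_pos[OF s] by simp
  qed
  also have "\<dots> = (\<Sum>e\<in>directed_edges E. \<Sum>s<n. ?w e * (d s * ppr n E A \<alpha> s (fst e)))"
    unfolding sum_distrib_left by (subst sum.swap) (simp add: mult.left_commute)
  also have "\<dots> = (\<Sum>e\<in>directed_edges E. ?w e * d (fst e))"
    unfolding sum_distrib_left[symmetric]
    by (intro sum.cong) (auto simp: sum_wdegree_ppr directed_edges_Sigma)
  also have "\<dots> = (1 - \<alpha>) / \<alpha> * (\<Sum>(u, v)\<in>directed_edges E. A $$ (u, v) / \<theta> (u, v))"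
    unfolding sum_distrib_left
  proof (intro sum.cong refl, clarify)
    fix u v assume "(u, v) \<in> directed_edges E"
    then have "d u \<noteq> 0" using d_pos[of u] by (auto simp: directed_edges_Sigma)
    then show "(1 - \<alpha>) / \<alpha> * (A $$ (u, v) / (d u * \<theta> (u, v))) * d (fst (u, v)) =
        (1 - \<alpha>) / \<alpha> * (A $$ (u, v) / \<theta> (u, v))"
      by simp
  qed
  finally show ?thesis .
qed

section \<open>The chosen thresholds and the expected cost\<close>

lemma sum_push_threshold_le:
  assumes "0 < r" "v < n"
  shows "(\<Sum>u\<in>neighbors E v. push_threshold E A r (u, v)) \<le> r * d v"
proof -
  let ?S = "\<Sum>x\<in>neighbors E v. sqrt (A $$ (x, v))"
  have "(\<Sum>u\<in>neighbors E v. push_threshold E A r (u, v)) = r * d v * (?S / ?S)"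
    by (simp flip: sum_distrib_left sum_divide_distrib)
  \<comment> \<open>The quotient \<open>?S / ?S\<close> is 1, or 0 when
    \<open>?S = 0\<close>.\<close>
  also have "\<dots> \<le> r * d v"
    using assms d_pos[of v] by (cases "?S = 0") auto
  finally show ?thesis .
qed

text \<open>By Cauchy-Schwarz, thresholds proportional to \<open>sqrt (A $$ (u, v))\<close> minimise
  the sum of \<open>A / \<theta>\<close> over the edges into \<open>v\<close> for a given total
  threshold; the value below is that minimum.\<close>

lemma sum_weight_div_push_threshold:
  assumes "0 < r"
  shows "(\<Sum>(u, v)\<in>directed_edges E. A $$ (u, v) / push_threshold E A r (u, v)) =
    (\<Sum>v<n. (\<Sum>x\<in>neighbors E v. sqrt (A $$ (x, v)))\<^sup>2 / d v) / r"
proof -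
  let ?S = "\<lambda>v. \<Sum>x\<in>neighbors E v. sqrt (A $$ (x, v))"
  have "(\<Sum>u\<in>neighbors E v. A $$ (u, v) / push_threshold E A r (u, v)) = (?S v)\<^sup>2 / d v / r"
    if v: "v < n" for v
  proof -
    have "(\<Sum>u\<in>neighbors E v. A $$ (u, v) / push_threshold E A r (u, v)) =
        (\<Sum>u\<in>neighbors E v. sqrt (A $$ (u, v)) * (?S v / (r * d v)))"
    proof (rule sum.cong[OF refl])
      fix u assume "u \<in> neighbors E v"
      then have "0 \<le> A $$ (u, v)" using neighbors_subset v A_nonneg by auto
      moreover have "A $$ (u, v) / push_threshold E A r (u, v) =
          A $$ (u, v) / sqrt (A $$ (u, v)) * (?S v / (r * d v))"
        by (simp add: ac_simps)
      \<comment> \<open>The identity \<open>x / sqrt x = sqrt x\<close> includes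
        \<open>x = 0\<close>, where both sides are 0.\<close>
      ultimately show "A $$ (u, v) / push_threshold E A r (u, v) =
          sqrt (A $$ (u, v)) * (?S v / (r * d v))"
        by (simp only: real_div_sqrt)
    qed
    also have "\<dots> = ?S v * (?S v / (r * d v))"
      by (rule sum_distrib_right[symmetric])
    finally show ?thesis by (simp add: power2_eq_square mult.commute)
  qed
  then show ?thesis
    by (simp add: sum_directed_edges sum_divide_distrib case_prod_beta del: push_threshold.simps)
qed

lemma expected_cost_le:
  assumes r: "0 < r" and c: "0 < c"
    and pos: "\<And>e. e \<in> directed_edges E \<Longrightarrow> 0 < push_threshold E A r e"
    and run: "\<And>s. s < n \<Longrightarrow> edge_push_run E A \<alpha> (push_threshold E A r) s (\<sigma> s) (N s)"
    and T: "\<And>s. s < n \<Longrightarrow> T s \<le> ennreal c * ennreal_of_enat (N s)"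
  shows "(\<integral>\<^sup>+ s. T s \<partial>measure_pmf (degree_distribution n E A))
    \<le> ennreal (c * ((1 - \<alpha>) / (\<alpha> * r * adj_norm1 E A) *
        (\<Sum>v<n. (\<Sum>x\<in>neighbors E v. sqrt (A $$ (x, v)))\<^sup>2 / d v)))"
proof -
  let ?W = "adj_norm1 E A" and ?K = "\<lambda>s. the_enat (N s)"
  let ?Z = "\<Sum>v<n. (\<Sum>x\<in>neighbors E v. sqrt (A $$ (x, v)))\<^sup>2 / d v"
  have W: "0 < ?W"
    unfolding sum_wdegree[OF graph, symmetric] using n_pos d_pos by (intro sum_pos) auto
  \<comment> \<open>Termination makes each \<open>N s\<close> finite, so \<open>the_enat\<close>
    loses nothing.\<close>
  have N: "N s = enat (?K s)" if "s < n" for s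
    using run_finite[OF pos run[OF that] that] by auto
  have "(\<integral>\<^sup>+ s. T s \<partial>measure_pmf (degree_distribution n E A)) =
      (\<integral>\<^sup>+ s. ennreal (pmf (degree_distribution n E A) s) * T s \<partial>count_space UNIV)"
    by (rule nn_integral_measure_pmf)
  also have "\<dots> = (\<Sum>s<n. ennreal (d s / ?W) * T s)"
    by (subst nn_integral_count_space'[where A = "{..<n}"])
      (auto simp: pmf_degree_distribution[OF graph])
  also have "\<dots> \<le> (\<Sum>s<n. ennreal (c / ?W * (d s * real (?K s))))"
  proof (rule sum_mono)
    fix s assume "s \<in> {..<n}"
    then have s: "s < n" by simp
    have "T s \<le> ennreal (c * real (?K s))"
      using T[OF s] c by (subst (asm) N[OF s]) (simp add: ennreal_mult ennreal_of_nat_eq_real_of_nat)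
    then have "ennreal (d s / ?W) * T s \<le> ennreal (d s / ?W) * ennreal (c * real (?K s))"
      by (rule mult_left_mono) simp
    also have "\<dots> = ennreal (c / ?W * (d s * real (?K s)))"
      using d_pos[OF s] W c by (simp add: mult.commute mult.left_commute flip: ennreal_mult)
    finally show "ennreal (d s / ?W) * T s \<le> ennreal (c / ?W * (d s * real (?K s)))" .
  qed
  also have "\<dots> = ennreal (c / ?W * (\<Sum>s<n. d s * real (?K s)))"
    unfolding sum_distrib_left using d_pos W c by (intro sum_ennreal) (auto simp: less_imp_le)
  also have "\<dots> \<le> ennreal (c / ?W * ((1 - \<alpha>) / \<alpha> * (?Z / r)))"
  proof (intro ennreal_leI mult_left_mono)
    have "edge_push_run E A \<alpha> (push_threshold E A r) s (\<sigma> s) (enat (?K s))" if "s < n" for s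
      using run[OF that] N[OF that] by simp
    from expected_push_count_le[OF pos this]
    show "(\<Sum>s<n. d s * real (?K s)) \<le> (1 - \<alpha>) / \<alpha> * (?Z / r)"
      by (simp only: sum_weight_div_push_threshold[OF r])
  qed (use W c in simp)
  also have "c / ?W * ((1 - \<alpha>) / \<alpha> * (?Z / r)) = c * ((1 - \<alpha>) / (\<alpha> * r * ?W) * ?Z)"
    by (simp add: field_simps)
  finally show ?thesis .
qed

end

text \<open>\<open>T s\<close> models the running time from source \<open>s\<close>, with
  \<open>c\<close> the amortised cost of a push; \<open>C\<close> depends on \<open>c\<close> alone.
  Positive thresholds exclude edges of weight 0, whose threshold would be 0 and which could be
  pushed forever.\<close>

theorem theorem5p5:
  shows
    "(\<forall>n E A \<alpha> r_max s \<sigma> N.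
        weighted_graph n E A \<longrightarrow> 0 < \<alpha> \<longrightarrow> \<alpha> < 1 \<longrightarrow> 0 < r_max \<longrightarrow> r_max < 1 \<longrightarrow>
        (\<forall>e\<in>directed_edges E. 0 < push_threshold E A r_max e) \<longrightarrow>
        s < n \<longrightarrow> edge_push_run E A \<alpha> (push_threshold E A r_max) s \<sigma> N \<longrightarrow>
        N \<noteq> \<infinity> \<and>
        (\<forall>t<n. \<bar>ppr n E A \<alpha> s t / wdegree E A t
                 - edge_push_output \<alpha> \<sigma> N t / wdegree E A t\<bar> \<le> r_max))
     \<and>
     (\<forall>c>0. \<exists>C>0. \<forall>n E A \<alpha> r_max (\<sigma> :: nat \<Rightarrow> nat \<Rightarrow> push_state) N (T :: nat \<Rightarrow> ennreal).
        weighted_graph n E A \<longrightarrow> 0 < \<alpha> \<longrightarrow> \<alpha> < 1 \<longrightarrow> 0 < r_max \<longrightarrow> r_max < 1 \<longrightarrow>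
        (\<forall>e\<in>directed_edges E. 0 < push_threshold E A r_max e) \<longrightarrow>
        (\<forall>s<n. edge_push_run E A \<alpha> (push_threshold E A r_max) s (\<sigma> s) (N s)) \<longrightarrow>
        (\<forall>s<n. T s \<le> ennreal c * ennreal_of_enat (N s)) \<longrightarrow>
        (\<integral>\<^sup>+ s. T s \<partial>measure_pmf (degree_distribution n E A))
          \<le> ennreal (C * ((1 - \<alpha>) / (\<alpha> * r_max * adj_norm1 E A) *
              (\<Sum>v<n. (\<Sum>x\<in>neighbors E v. sqrt (A $$ (x, v)))\<^sup>2 / wdegree E A v))))"
proof (intro conjI allI impI)
  fix n E A \<alpha> r_max s \<sigma> N
  assume g: "weighted_graph n E A" "0 < \<alpha>" "\<alpha> < 1" and r: "0 < r_max"
    and pos: "\<forall>e\<in>directed_edges E. 0 < push_threshold E A r_max e"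
    and s: "s < n" and run: "edge_push_run E A \<alpha> (push_threshold E A r_max) s \<sigma> N"
  interpret ppr_graph n E A \<alpha> by unfold_locales (use g in auto)
  show "N \<noteq> \<infinity>"
    using pos by (intro run_finite[OF _ run s]) blast
  show "\<bar>ppr n E A \<alpha> s t / wdegree E A t - edge_push_output \<alpha> \<sigma> N t / wdegree E A t\<bar> \<le> r_max"
    if "t < n" for t
    using pos by (intro run_error[OF _ run s that sum_push_threshold_le[OF r]]) blast
next
  fix c :: real assume c: "0 < c"
  show "\<exists>C>0. \<forall>n E A \<alpha> r_max (\<sigma> :: nat \<Rightarrow> nat \<Rightarrow> push_state) N (T :: nat \<Rightarrow> ennreal).
        weighted_graph n E A \<longrightarrow> 0 < \<alpha> \<longrightarrow> \<alpha> < 1 \<longrightarrow> 0 < r_max \<longrightarrow> r_max < 1 \<longrightarrow>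
        (\<forall>e\<in>directed_edges E. 0 < push_threshold E A r_max e) \<longrightarrow>
        (\<forall>s<n. edge_push_run E A \<alpha> (push_threshold E A r_max) s (\<sigma> s) (N s)) \<longrightarrow>
        (\<forall>s<n. T s \<le> ennreal c * ennreal_of_enat (N s)) \<longrightarrow>
        (\<integral>\<^sup>+ s. T s \<partial>measure_pmf (degree_distribution n E A))
          \<le> ennreal (C * ((1 - \<alpha>) / (\<alpha> * r_max * adj_norm1 E A) *
              (\<Sum>v<n. (\<Sum>x\<in>neighbors E v. sqrt (A $$ (x, v)))\<^sup>2 / wdegree E A v)))"
  \<comment> \<open>The expected push count is bounded with constant 1, so the cost per push itself
    serves as \<open>C\<close>.\<close>
  proof (intro exI[of _ c] conjI allI impI)
    fix n E A \<alpha> r_max and \<sigma> :: "nat \<Rightarrow> nat \<Rightarrow> push_state" and N and T :: "nat \<Rightarrow> ennreal"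
    assume "weighted_graph n E A" "0 < \<alpha>" "\<alpha> < 1" and r: "0 < r_max"
      and pos: "\<forall>e\<in>directed_edges E. 0 < push_threshold E A r_max e"
      and run: "\<forall>s<n. edge_push_run E A \<alpha> (push_threshold E A r_max) s (\<sigma> s) (N s)"
      and T: "\<forall>s<n. T s \<le> ennreal c * ennreal_of_enat (N s)"
    then interpret ppr_graph n E A \<alpha> by unfold_locales auto
    show "(\<integral>\<^sup>+ s. T s \<partial>measure_pmf (degree_distribution n E A))
          \<le> ennreal (c * ((1 - \<alpha>) / (\<alpha> * r_max * adj_norm1 E A) *
              (\<Sum>v<n. (\<Sum>x\<in>neighbors E v. sqrt (A $$ (x, v)))\<^sup>2 / wdegree E A v)))"
      by (rule expected_cost_le[OF r c, of \<sigma> N]) (use pos run T in blast)+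
  qed (rule c)
qed

end
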